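(* Let $G$ be a finite transitive graph. Let $r \in \mathbb N$. Then $B_r$ does not disconnect $B_{2r}^c$.
   Context: Graphs are connected, simple and locally finite; transitive means that the automorphism group acts transitively on vertices. $B_r$ is the graph-metric ball of radius $r$ around an arbitrary fixed vertex $o$, and $A^c$ is the complement of $A$ in the vertex set. A set of vertices $A$ disconnects a set of vertices $B$ if there exist $b_1,b_2\in B$ such that there is no finite path from $b_1$ to $b_2$ whose vertices other than its two endpoints all lie in $A^c$. *)

theory Defs
  imports "Graph_Theory.Graph_Theory"
begin

(* Finite simple graphs are the symmetric digraphs of the locale graph: an undirected edge
   {u, v} is a pair of opposite arcs, with neither loops nor parallel arcs. *)

definition automorphism ::
    "('a, 'b) pre_digraph \<Rightarrow> ('a, 'b, 'a, 'b) digraph_isomorphism \<Rightarrow> bool" where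
  "automorphism G hom \<longleftrightarrow>
     pre_digraph.digraph_isomorphism G hom \<and> app_iso hom G = G"

definition vertex_transitive :: "('a, 'b) pre_digraph \<Rightarrow> bool" where
  "vertex_transitive G \<longleftrightarrow>
     (\<forall>u \<in> verts G. \<forall>v \<in> verts G. \<exists>hom. automorphism G hom \<and> iso_verts hom u = v)"

(* The shortest-path cost for unit weights is the graph metric. *)
definition graph_ball :: "('a, 'b) pre_digraph \<Rightarrow> 'a \<Rightarrow> nat \<Rightarrow> 'a set" where
  "graph_ball G c r = {v \<in> verts G. wf_digraph.\<mu> G (\<lambda>_. 1) c v \<le> ereal (real r)}"

(* The endpoints b1, b2 themselves may lie in A; for b1 = b2 the trivial path is allowed. *)
definition disconnects :: "('a, 'b) pre_digraph \<Rightarrow> 'a set \<Rightarrow> 'a set \<Rightarrow> bool" where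
  "disconnects G A B \<longleftrightarrow>
     (\<exists>b1 \<in> B. \<exists>b2 \<in> B. \<not> (\<exists>p. pre_digraph.apath G b1 p b2 \<and>
        set (pre_digraph.awalk_verts G b1 p) - {b1, b2} \<subseteq> verts G - A))"

lemma (in graph) automorphism_iff_bij_betw:
  "(\<exists>hom. automorphism G hom \<and> iso_verts hom = f) \<longleftrightarrow>
     bij_betw f (verts G) (verts G) \<and>
     (\<forall>u \<in> verts G. \<forall>v \<in> verts G. u \<rightarrow>\<^bsub>G\<^esub> v \<longleftrightarrow> f u \<rightarrow>\<^bsub>G\<^esub> f v)"
    (is "?L \<longleftrightarrow> ?R")
proof
  assume ?L
  then obtain hom where iso: "digraph_isomorphism hom" and eq: "app_iso hom G = G"
    and f: "iso_verts hom = f" by (auto simp: automorphism_def)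
  have V: "f ` verts G = verts G" and A: "iso_arcs hom ` arcs G = arcs G"
    and T: "iso_tail hom = tail G" and H: "iso_head hom = head G"
    using app_iso_simps[of hom G] f unfolding eq by simp_all
  have inj: "inj_on f (verts G)" using iso f by (simp add: digraph_isomorphism_def)
  have th: "f (tail G a) = tail G (iso_arcs hom a)" "f (head G a) = head G (iso_arcs hom a)"
    if "a \<in> arcs G" for a
    using iso that f T H by (auto simp: digraph_isomorphism_def)
  have "u \<rightarrow>\<^bsub>G\<^esub> v \<longleftrightarrow> f u \<rightarrow>\<^bsub>G\<^esub> f v" if uv: "u \<in> verts G" "v \<in> verts G" for u v
  proof
    assume "u \<rightarrow>\<^bsub>G\<^esub> v"
    then obtain a where "a \<in> arcs G" "tail G a = u" "head G a = v" by (rule reachableE)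
    then show "f u \<rightarrow>\<^bsub>G\<^esub> f v"
      using th[of a] A by (intro dominatesI[of "iso_arcs hom a"]) (auto simp: arc_to_ends_def)
  next
    assume "f u \<rightarrow>\<^bsub>G\<^esub> f v"
    then obtain b where b: "b \<in> arcs G" "tail G b = f u" "head G b = f v" by (rule reachableE)
    then obtain a where a: "a \<in> arcs G" "b = iso_arcs hom a" using A by auto
    then have "f (tail G a) = f u" "f (head G a) = f v" using th[of a] b by auto
    then have "tail G a = u" "head G a = v" using inj uv a(1) by (auto dest: inj_onD)
    then show "u \<rightarrow>\<^bsub>G\<^esub> v" using a by (intro dominatesI[of a]) (auto simp: arc_to_ends_def)
  qed
  then show ?R using inj V by (auto simp: bij_betw_def)
next
  assume R: ?R
  define g where "g a = (SOME b. b \<in> arcs G \<and> tail G b = f (tail G a) \<and> head G b = f (head G a))" for a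
  have g: "g a \<in> arcs G \<and> tail G (g a) = f (tail G a) \<and> head G (g a) = f (head G a)"
    if "a \<in> arcs G" for a
  proof -
    have "tail G a \<rightarrow>\<^bsub>G\<^esub> head G a"
      using that by (intro dominatesI[of a]) (auto simp: arc_to_ends_def)
    then have "f (tail G a) \<rightarrow>\<^bsub>G\<^esub> f (head G a)" using R that by auto
    then obtain b where "b \<in> arcs G \<and> tail G b = f (tail G a) \<and> head G b = f (head G a)"
      by (auto elim: reachableE)
    then show ?thesis unfolding g_def by (rule someI)
  qed
  have inj: "inj_on f (verts G)" and V: "f ` verts G = verts G"
    using R by (auto simp: bij_betw_def)
  have ig: "inj_on g (arcs G)"
  proof (rule inj_onI)
    fix a b assume ab: "a \<in> arcs G" "b \<in> arcs G" "g a = g b"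
    then have "f (tail G a) = f (tail G b)" "f (head G a) = f (head G b)"
      using g[of a] g[of b] by auto
    then have "tail G a = tail G b" "head G a = head G b"
      using ab inj by (auto dest: inj_onD)
    then show "a = b" using ab no_multi_arcs by (auto simp: arc_to_ends_def)
  qed
  have gA: "g ` arcs G = arcs G"
    using ig g by (intro endo_inj_surj) auto
  let ?h = "\<lparr> iso_verts = f, iso_arcs = g, iso_head = head G, iso_tail = tail G \<rparr>"
  have "digraph_isomorphism ?h"
    using inj ig g wf_digraph by (auto simp: digraph_isomorphism_def)
  moreover have "app_iso ?h G = G" using V gA by (simp add: app_iso_def)
  ultimately show ?L unfolding automorphism_def by (intro exI[of _ ?h]) simp
qed

lemma (in wf_digraph) mem_graph_ball_iff:
  "v \<in> graph_ball G c r \<longleftrightarrow> (\<exists>p. awalk c p v \<and> length p \<le> r)"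
proof -
  have cost: "awalk_cost (\<lambda>_. 1) p = real (length p)" for p by (induct p) auto
  have "\<exists>p. awalk c p v \<and> length p \<le> r" if "\<mu> (\<lambda>_. 1) c v \<le> ereal (real r)"
  proof -
    have "\<mu> (\<lambda>_. 1) c v < ereal (real r + 1)"
      by (rule le_less_trans[OF that]) simp
    then obtain p where "awalk c p v" "awalk_cost (\<lambda>_. 1) p < real r + 1"
      unfolding \<mu>_def by (auto simp: INF_less_iff)
    then show ?thesis unfolding cost by (intro exI[of _ p]) linarith
  qed
  moreover have "v \<in> verts G \<and> \<mu> (\<lambda>_. 1) c v \<le> ereal (real r)"
    if "awalk c p v" "length p \<le> r" for p
    using min_cost_le_walk_cost[OF that(1), of "\<lambda>_. 1"] that
    by (auto simp: cost elim!: order_trans)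
  ultimately show ?thesis unfolding graph_ball_def by auto
qed

end

theory Submission
  imports Defs
begin

text \<open>
  Suppose that removing some ball \<open>B x r\<close> separates two vertices at distance more than \<open>2r\<close>
  from \<open>x\<close>. By transitivity this then happens at every centre, so among all centres \<open>x\<close> and all
  pairs \<open>b1\<close>, \<open>b2\<close> separated in this way one may take a triple for which the component \<open>K\<close> of
  \<open>b1\<close> in the exterior of \<open>B x r\<close> has as few vertices as possible; this is where finiteness enters.

  Now move the ball into \<open>K\<close>: let \<open>y = b1\<close>. As \<open>y\<close> is at distance more than \<open>2r\<close> from \<open>x\<close>, the
  balls \<open>B y r\<close> and \<open>B x r\<close> are disjoint. Since \<open>B y r\<close> is connected, it lies inside \<open>K\<close>; and
  \<open>B x r\<close>, together with all the components of its exterior other than \<open>K\<close>, lies in a single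
  component of the exterior of \<open>B y r\<close>, namely that of \<open>x\<close>
  (\<open>exterior_component_contains_complement\<close>). Every other component of the exterior of \<open>B y r\<close>
  is therefore contained in \<open>K\<close>, and properly so because it misses \<open>y\<close>. By transitivity \<open>B y r\<close>
  also separates two vertices at distance more than \<open>2r\<close> from \<open>y\<close>, and at least one of these is
  not in the component of \<open>x\<close>. Its component is smaller than \<open>K\<close>, a contradiction.
\<close>

section \<open>Balls in the graph metric\<close>

lemma (in wf_digraph) graph_ball_0:
  assumes "c \<in> verts G"
  shows "graph_ball G c 0 = {c}"
  using assms by (auto simp: mem_graph_ball_iff awalk_Nil_iff)

lemma (in wf_digraph) graph_ball_subset_verts: "graph_ball G c r \<subseteq> verts G"
  by (auto simp: graph_ball_def)

lemma (in wf_digraph) graph_ball_mono: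
  "r \<le> s \<Longrightarrow> graph_ball G c r \<subseteq> graph_ball G c s"
  unfolding mem_graph_ball_iff subset_iff by (meson le_trans)

lemma (in wf_digraph) centre_in_graph_ball:
  "c \<in> verts G \<Longrightarrow> c \<in> graph_ball G c r"
  using graph_ball_0[of c] graph_ball_mono[of 0 r c] by auto

text \<open>
  Splitting off the last arc of a walk turns balls into an object defined by recursion on the
  radius; the facts about balls below are all proved by induction along this recursion.
\<close>

lemma (in wf_digraph) mem_graph_ball_Suc_iff:
  "v \<in> graph_ball G c (Suc r) \<longleftrightarrow>
     v \<in> graph_ball G c r \<or> (\<exists>u \<in> graph_ball G c r. u \<rightarrow>\<^bsub>G\<^esub> v)" (is "?L \<longleftrightarrow> ?R")
proof
  assume ?L
  then obtain p where p: "awalk c p v" "length p \<le> Suc r" by (auto simp: mem_graph_ball_iff)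
  show ?R
  proof (cases p rule: rev_cases)
    case Nil
    then show ?thesis using p by (auto simp: mem_graph_ball_iff)
  next
    case (snoc q a)
    then have "awalk c q (tail G a)" "a \<in> arcs G" "head G a = v" "length q \<le> r"
      using p by (auto simp: awalk_simps)
    then have "tail G a \<in> graph_ball G c r" "tail G a \<rightarrow>\<^bsub>G\<^esub> v"
      by (auto simp: mem_graph_ball_iff dest: in_arcs_imp_in_arcs_ends)
    then show ?thesis by blast
  qed
next
  assume ?R
  then show ?L
  proof
    assume "v \<in> graph_ball G c r"
    then show ?thesis using graph_ball_mono[of r "Suc r" c] by auto
  next
    assume "\<exists>u \<in> graph_ball G c r. u \<rightarrow>\<^bsub>G\<^esub> v"
    then obtain u p a where "awalk c p u" "length p \<le> r"
      and a: "a \<in> arcs G" "tail G a = u" "head G a = v"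
      by (auto simp: mem_graph_ball_iff elim!: reachableE)
    moreover have "awalk u [a] v" using a by (auto simp: awalk_simps)
    ultimately show ?thesis
      unfolding mem_graph_ball_iff by (intro exI[of _ "p @ [a]"]) auto
  qed
qed

text \<open>
  The triangle inequality through a common point: the walk from \<open>y\<close> to \<open>z\<close> is reversed and
  appended to the one from \<open>x\<close> to \<open>z\<close>. The induction does this arc by arc, moving \<open>z\<close> back
  towards \<open>y\<close>; each step takes one unit from \<open>s\<close> and adds it to \<open>r\<close>.
\<close>

lemma (in sym_digraph) graph_balls_meetD:
  assumes "z \<in> graph_ball G x r" "z \<in> graph_ball G y s" "y \<in> verts G"
  shows "y \<in> graph_ball G x (r + s)"
  using assms(1,2)
proof (induction s arbitrary: z r)
  case 0
  then show ?case using graph_ball_0[OF assms(3)] by auto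
next
  case (Suc s)
  consider "z \<in> graph_ball G y s" | u where "u \<in> graph_ball G y s" "u \<rightarrow>\<^bsub>G\<^esub> z"
    using Suc.prems(2) by (auto simp: mem_graph_ball_Suc_iff)
  then show ?case
  proof cases
    case 1
    then have "y \<in> graph_ball G x (r + s)" using Suc by blast
    then show ?thesis using graph_ball_mono[of "r + s" "r + Suc s" x] by auto
  next
    case 2
    then have "u \<in> graph_ball G x (Suc r)"
      using Suc.prems(1) graph_symmetric by (auto simp: mem_graph_ball_Suc_iff)
    then have "y \<in> graph_ball G x (Suc r + s)" using 2(1) by (rule Suc.IH)
    then show ?thesis by simp
  qed
qed

lemma (in sym_digraph) graph_balls_disjoint:
  assumes "y \<in> verts G" "y \<notin> graph_ball G x (2 * r)"
  shows "graph_ball G x r \<inter> graph_ball G y r = {}"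
  using assms graph_balls_meetD[of _ x r y r] by (auto simp: mult_2)

lemma (in wf_digraph) reachable_within_graph_ball:
  assumes "c \<in> verts G" "graph_ball G c r \<subseteq> S" "v \<in> graph_ball G c r"
  shows "c \<rightarrow>\<^sup>*\<^bsub>G \<restriction> S\<^esub> v"
  using assms(2,3)
proof (induction r arbitrary: v)
  case 0
  then show ?case using graph_ball_0[OF assms(1)] by (auto simp: reachable_def)
next
  case (Suc r)
  interpret S: wf_digraph "G \<restriction> S" by auto
  have sub: "graph_ball G c r \<subseteq> S" using Suc.prems graph_ball_mono[of r "Suc r" c] by auto
  consider "v \<in> graph_ball G c r" | u where "u \<in> graph_ball G c r" "u \<rightarrow>\<^bsub>G\<^esub> v"
    using Suc.prems by (auto simp: mem_graph_ball_Suc_iff)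
  then show ?case
  proof cases
    case 1
    then show ?thesis using Suc.IH sub by blast
  next
    case 2
    then have "u \<rightarrow>\<^bsub>G \<restriction> S\<^esub> v"
      using sub Suc.prems by (auto simp: arcs_ends_conv)
    then show ?thesis using Suc.IH[OF sub 2(1)] S.reachable_adj_trans by blast
  qed
qed

section \<open>Automorphisms and balls\<close>

text \<open>
  The implication from left to right rests on surjectivity: the last vertex before \<open>f v\<close> on a
  walk from \<open>f c\<close> has a preimage under \<open>f\<close>.
\<close>

lemma (in wf_digraph) graph_ball_image_iff:
  assumes bij: "bij_betw f (verts G) (verts G)"
    and adj: "\<And>u v. u \<in> verts G \<Longrightarrow> v \<in> verts G \<Longrightarrow> u \<rightarrow>\<^bsub>G\<^esub> v \<longleftrightarrow> f u \<rightarrow>\<^bsub>G\<^esub> f v"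
    and c: "c \<in> verts G" and v: "v \<in> verts G"
  shows "f v \<in> graph_ball G (f c) r \<longleftrightarrow> v \<in> graph_ball G c r"
  using v
proof (induction r arbitrary: v)
  case 0
  then show ?case
    using graph_ball_0[OF c] graph_ball_0[of "f c"] bij c
    by (auto simp: bij_betw_def dest: inj_onD)
next
  case (Suc r)
  have "(\<exists>w \<in> graph_ball G (f c) r. w \<rightarrow>\<^bsub>G\<^esub> f v) \<longleftrightarrow>
      (\<exists>u \<in> verts G. f u \<in> graph_ball G (f c) r \<and> f u \<rightarrow>\<^bsub>G\<^esub> f v)"
  proof
    assume "\<exists>w \<in> graph_ball G (f c) r. w \<rightarrow>\<^bsub>G\<^esub> f v"
    then obtain w where w: "w \<in> graph_ball G (f c) r" "w \<rightarrow>\<^bsub>G\<^esub> f v" by (rule bexE)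
    then have "w \<in> f ` verts G"
      using graph_ball_subset_verts[of "f c" r] bij by (auto simp: bij_betw_def)
    then obtain u where "u \<in> verts G" "w = f u" by (rule imageE) simp
    then show "\<exists>u \<in> verts G. f u \<in> graph_ball G (f c) r \<and> f u \<rightarrow>\<^bsub>G\<^esub> f v" using w by metis
  qed metis
  also have "\<dots> \<longleftrightarrow> (\<exists>u \<in> graph_ball G c r. u \<rightarrow>\<^bsub>G\<^esub> v)"
  proof -
    have "u \<in> verts G \<and> f u \<in> graph_ball G (f c) r \<and> f u \<rightarrow>\<^bsub>G\<^esub> f v \<longleftrightarrow>
        u \<in> graph_ball G c r \<and> u \<rightarrow>\<^bsub>G\<^esub> v" for u
      using Suc.IH[of u] adj[OF _ Suc.prems, of u] graph_ball_subset_verts[of c r] by auto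
    then show ?thesis by blast
  qed
  finally show ?case using Suc by (simp add: mem_graph_ball_Suc_iff)
qed

section \<open>Components of the exterior of a ball\<close>

definition ball_exterior :: "('a, 'b) pre_digraph \<Rightarrow> 'a \<Rightarrow> nat \<Rightarrow> ('a, 'b) pre_digraph" where
  "ball_exterior G c r = G \<restriction> (verts G - graph_ball G c r)"

lemma verts_ball_exterior [simp]: "verts (ball_exterior G c r) = verts G - graph_ball G c r"
  by (simp add: ball_exterior_def)

lemma (in wf_digraph) dominates_ball_exterior_iff:
  "u \<rightarrow>\<^bsub>ball_exterior G c r\<^esub> v \<longleftrightarrow>
     u \<rightarrow>\<^bsub>G\<^esub> v \<and> u \<notin> graph_ball G c r \<and> v \<notin> graph_ball G c r"
  by (auto simp: ball_exterior_def arcs_ends_conv)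

lemma (in sym_digraph) sym_digraph_ball_exterior: "sym_digraph (ball_exterior G c r)"
  unfolding ball_exterior_def by (rule induced_graph_imp_graph) auto

lemma (in wf_digraph) ball_exterior_reachable_image:
  assumes bij: "bij_betw f (verts G) (verts G)"
    and adj: "\<And>u v. u \<in> verts G \<Longrightarrow> v \<in> verts G \<Longrightarrow> u \<rightarrow>\<^bsub>G\<^esub> v \<longleftrightarrow> f u \<rightarrow>\<^bsub>G\<^esub> f v"
    and c: "c \<in> verts G" and uv: "u \<rightarrow>\<^sup>*\<^bsub>ball_exterior G c r\<^esub> v"
  shows "f u \<rightarrow>\<^sup>*\<^bsub>ball_exterior G (f c) r\<^esub> f v"
proof -
  interpret E: wf_digraph "ball_exterior G c r" unfolding ball_exterior_def by auto
  interpret F: wf_digraph "ball_exterior G (f c) r" unfolding ball_exterior_def by auto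
  have ball: "f w \<in> graph_ball G (f c) r \<longleftrightarrow> w \<in> graph_ball G c r" if "w \<in> verts G" for w
    using graph_ball_image_iff[OF bij adj c that] .
  show ?thesis
    using uv
  proof (induction rule: E.converse_reachable_induct)
    case base
    then show ?case using ball bij by (auto simp: bij_betw_def)
  next
    case (step w w')
    then have ww': "w \<rightarrow>\<^bsub>G\<^esub> w'" "w \<notin> graph_ball G c r" "w' \<notin> graph_ball G c r"
      by (simp_all add: dominates_ball_exterior_iff)
    have "f w \<rightarrow>\<^bsub>ball_exterior G (f c) r\<^esub> f w'"
      unfolding dominates_ball_exterior_iff
      using ww' adj[of w w'] ball[of w] ball[of w'] adj_in_verts[OF ww'(1)] by simp
    then show ?case using step.IH by (rule F.adj_reachable_trans)
  qed
qed

text \<open>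
  A walk in \<open>G\<close> from \<open>w\<close> to \<open>x\<close> starts outside the component of \<open>y\<close> and cannot enter
  it before having visited \<open>graph_ball G x r\<close>. As \<open>graph_ball G y r\<close> is inside that component,
  the part of the walk up to the first visit avoids \<open>graph_ball G y r\<close>, and from there \<open>x\<close> is
  reached inside \<open>graph_ball G x r\<close>.
\<close>

lemma (in sym_digraph) exterior_component_contains_complement:
  assumes y: "y \<in> verts G" and far: "y \<notin> graph_ball G x (2 * r)"
    and wx: "w \<rightarrow>\<^sup>*\<^bsub>G\<^esub> x" and nin: "\<not> y \<rightarrow>\<^sup>*\<^bsub>ball_exterior G x r\<^esub> w"
  shows "w \<rightarrow>\<^sup>*\<^bsub>ball_exterior G y r\<^esub> x"
proof -
  interpret X: sym_digraph "ball_exterior G x r" by (rule sym_digraph_ball_exterior)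
  interpret Y: sym_digraph "ball_exterior G y r" by (rule sym_digraph_ball_exterior)
  have x: "x \<in> verts G" using wx by (rule reachable_in_verts)
  have disj: "graph_ball G x r \<inter> graph_ball G y r = {}"
    using y far by (rule graph_balls_disjoint)
  have in_K: "y \<rightarrow>\<^sup>*\<^bsub>ball_exterior G x r\<^esub> v" if "v \<in> graph_ball G y r" for v
    unfolding ball_exterior_def
    using y that disj graph_ball_subset_verts by (intro reachable_within_graph_ball) auto
  have to_x: "v \<rightarrow>\<^sup>*\<^bsub>ball_exterior G y r\<^esub> x" if "v \<in> graph_ball G x r" for v
  proof -
    have "x \<rightarrow>\<^sup>*\<^bsub>ball_exterior G y r\<^esub> v"
      unfolding ball_exterior_def
      using x that disj graph_ball_subset_verts by (intro reachable_within_graph_ball) auto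
    then show ?thesis by (rule Y.symmetric_reachable')
  qed
  show ?thesis
    using wx nin
  proof (induction rule: converse_reachable_induct)
    case base
    show ?case by (intro to_x centre_in_graph_ball x)
  next
    case (step w w')
    show ?case
    proof (cases "w \<in> graph_ball G x r")
      case True
      then show ?thesis by (rule to_x)
    next
      case False
      have w': "\<not> y \<rightarrow>\<^sup>*\<^bsub>ball_exterior G x r\<^esub> w'"
      proof
        assume K: "y \<rightarrow>\<^sup>*\<^bsub>ball_exterior G x r\<^esub> w'"
        then have "w' \<notin> graph_ball G x r" using X.reachable_in_verts(2)[OF K] by simp
        then have "w' \<rightarrow>\<^bsub>ball_exterior G x r\<^esub> w"
          using graph_symmetric[OF step.hyps(1)] False by (simp add: dominates_ball_exterior_iff)
        then show False using X.reachable_adj_trans[OF K] step.prems by simp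
      qed
      have "w \<notin> graph_ball G y r" "w' \<notin> graph_ball G y r"
        using in_K step.prems w' by blast+
      then have "w \<rightarrow>\<^bsub>ball_exterior G y r\<^esub> w'"
        using step.hyps by (simp add: dominates_ball_exterior_iff)
      then show ?thesis using step.IH[OF w'] by (rule Y.adj_reachable_trans)
    qed
  qed
qed

text \<open>
  A component of the exterior of \<open>graph_ball G b1 r\<close> other than that of \<open>x\<close> cannot leave the
  component of \<open>b1\<close>, because all vertices outside the latter are joined to \<open>x\<close>. The inclusion
  is strict at \<open>b1\<close>, a vertex of the removed ball.
\<close>

lemma (in sym_digraph) exterior_component_shrinks:
  assumes conn: "Digraph_Component.connected G"
    and b: "b1 \<in> verts G" "b1 \<notin> graph_ball G x (2 * r)" and x: "x \<in> verts G"
    and c: "\<not> c \<rightarrow>\<^sup>*\<^bsub>ball_exterior G b1 r\<^esub> x"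
  shows "{w. c \<rightarrow>\<^sup>*\<^bsub>ball_exterior G b1 r\<^esub> w} \<subset> {w. b1 \<rightarrow>\<^sup>*\<^bsub>ball_exterior G x r\<^esub> w}"
proof -
  interpret X: sym_digraph "ball_exterior G x r" by (rule sym_digraph_ball_exterior)
  interpret B: sym_digraph "ball_exterior G b1 r" by (rule sym_digraph_ball_exterior)
  have "b1 \<rightarrow>\<^sup>*\<^bsub>ball_exterior G x r\<^esub> w" if cw: "c \<rightarrow>\<^sup>*\<^bsub>ball_exterior G b1 r\<^esub> w" for w
  proof (rule ccontr)
    assume "\<not> ?thesis"
    moreover have "w \<rightarrow>\<^sup>*\<^bsub>G\<^esub> x"
      using symmetric_connected_imp_strongly_connected[OF sym_arcs conn] x
        B.reachable_in_verts(2)[OF cw] by auto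
    ultimately have "w \<rightarrow>\<^sup>*\<^bsub>ball_exterior G b1 r\<^esub> x"
      using exterior_component_contains_complement b by blast
    then show False using c B.reachable_trans[OF cw] by simp
  qed
  moreover have "b1 \<rightarrow>\<^sup>*\<^bsub>ball_exterior G x r\<^esub> b1"
    using b graph_ball_mono[of r "2 * r" x] by (intro X.reachable_refl) auto
  moreover have "\<not> c \<rightarrow>\<^sup>*\<^bsub>ball_exterior G b1 r\<^esub> b1"
    using B.reachable_in_verts(2)[of c b1] centre_in_graph_ball[OF b(1)] by auto
  ultimately show ?thesis by blast
qed

section \<open>Separation far from the centre\<close>

text \<open>
  The automorphism \<open>f\<close> maps the new centre \<open>y\<close> to the old centre \<open>x\<close>, and \<open>c1\<close>, \<open>c2\<close> are
  preimages: a connection between them outside the ball around \<open>y\<close> would be carried by \<open>f\<close> to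
  one between \<open>b1\<close> and \<open>b2\<close>.
\<close>

lemma (in graph) ball_separation_moves:
  assumes "vertex_transitive G" "x \<in> verts G" "y \<in> verts G"
    and b1: "b1 \<in> verts G - graph_ball G x s" and b2: "b2 \<in> verts G - graph_ball G x s"
    and sep: "\<not> b1 \<rightarrow>\<^sup>*\<^bsub>ball_exterior G x r\<^esub> b2"
  obtains c1 c2 where "c1 \<in> verts G - graph_ball G y s" "c2 \<in> verts G - graph_ball G y s"
    "\<not> c1 \<rightarrow>\<^sup>*\<^bsub>ball_exterior G y r\<^esub> c2"
proof -
  obtain hom where "automorphism G hom" and x: "iso_verts hom y = x"
    using assms(1-3) unfolding vertex_transitive_def by blast
  then have "\<exists>hom'. automorphism G hom' \<and> iso_verts hom' = iso_verts hom" by blast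
  then obtain f where bij: "bij_betw f (verts G) (verts G)" and x: "f y = x"
    and adj: "\<And>u v. u \<in> verts G \<Longrightarrow> v \<in> verts G \<Longrightarrow> u \<rightarrow>\<^bsub>G\<^esub> v \<longleftrightarrow> f u \<rightarrow>\<^bsub>G\<^esub> f v"
    using x unfolding automorphism_iff_bij_betw by blast
  have "b1 \<in> f ` verts G" "b2 \<in> f ` verts G" using bij b1 b2 by (auto simp: bij_betw_def)
  then obtain c1 c2 where c: "c1 \<in> verts G" "f c1 = b1" "c2 \<in> verts G" "f c2 = b2" by blast
  have "f v \<in> graph_ball G x s \<longleftrightarrow> v \<in> graph_ball G y s" if "v \<in> verts G" for v
    using graph_ball_image_iff[OF bij adj assms(3) that] unfolding x .
  then have "c1 \<in> verts G - graph_ball G y s" "c2 \<in> verts G - graph_ball G y s"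
    using c b1 b2 by auto
  moreover have "\<not> c1 \<rightarrow>\<^sup>*\<^bsub>ball_exterior G y r\<^esub> c2"
    using ball_exterior_reachable_image[OF bij adj assms(3), of r c1 c2] x c sep by auto
  ultimately show thesis by (rule that)
qed

text \<open>
  The minimal choice of a component is phrased as infinite descent on its cardinality, over all
  centres simultaneously: the smaller component produced from a separation at \<open>x\<close> belongs to a
  separation at \<open>b1\<close>.
\<close>

lemma (in graph) ball_exterior_connects_far_vertices:
  assumes conn: "Digraph_Component.connected G" and trans: "vertex_transitive G"
    and "x \<in> verts G"
    and "b1 \<in> verts G - graph_ball G x (2 * r)" "b2 \<in> verts G - graph_ball G x (2 * r)"
  shows "b1 \<rightarrow>\<^sup>*\<^bsub>ball_exterior G x r\<^esub> b2"
  using assms(3-5)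
proof (induction "card {w. b1 \<rightarrow>\<^sup>*\<^bsub>ball_exterior G x r\<^esub> w}" arbitrary: x b1 b2 rule: less_induct)
  case less
  interpret X: sym_digraph "ball_exterior G x r" by (rule sym_digraph_ball_exterior)
  interpret B: sym_digraph "ball_exterior G b1 r" by (rule sym_digraph_ball_exterior)
  show ?case
  proof (rule ccontr)
    assume "\<not> ?case"
    then obtain c1 c2 where c: "c1 \<in> verts G - graph_ball G b1 (2 * r)"
        "c2 \<in> verts G - graph_ball G b1 (2 * r)" "\<not> c1 \<rightarrow>\<^sup>*\<^bsub>ball_exterior G b1 r\<^esub> c2"
      using ball_separation_moves[OF trans, of x b1 b1 "2 * r" b2 r] less.prems by blast
    \<comment> \<open>The centre \<open>x\<close> is in the component of at most one of \<open>c1\<close> and \<open>c2\<close>.\<close>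
    obtain c d where cd: "c \<in> verts G - graph_ball G b1 (2 * r)"
        "d \<in> verts G - graph_ball G b1 (2 * r)" "\<not> c \<rightarrow>\<^sup>*\<^bsub>ball_exterior G b1 r\<^esub> d"
        "\<not> c \<rightarrow>\<^sup>*\<^bsub>ball_exterior G b1 r\<^esub> x"
      using c B.reachable_trans B.symmetric_reachable' by metis
    have "{w. c \<rightarrow>\<^sup>*\<^bsub>ball_exterior G b1 r\<^esub> w} \<subset> {w. b1 \<rightarrow>\<^sup>*\<^bsub>ball_exterior G x r\<^esub> w}"
      using exterior_component_shrinks[OF conn] cd less.prems by blast
    moreover have "finite {w. b1 \<rightarrow>\<^sup>*\<^bsub>ball_exterior G x r\<^esub> w}"
      using X.reachable_in_verts(2) by (intro finite_subset[OF _ finite_verts]) auto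
    ultimately have "card {w. c \<rightarrow>\<^sup>*\<^bsub>ball_exterior G b1 r\<^esub> w} <
        card {w. b1 \<rightarrow>\<^sup>*\<^bsub>ball_exterior G x r\<^esub> w}"
      by (metis psubset_card_mono)
    then have "c \<rightarrow>\<^sup>*\<^bsub>ball_exterior G b1 r\<^esub> d"
      by (rule less.hyps) (use less.prems cd in simp_all)
    then show False using cd by simp
  qed
qed

theorem lemma3p19:
  fixes G :: "('a, 'b) pre_digraph" and root :: 'a and r :: nat
  assumes "graph G"
    and "Digraph_Component.connected G"
    and "vertex_transitive G"
    and "root \<in> verts G"
  shows "\<not> disconnects G (graph_ball G root r) (verts G - graph_ball G root (2 * r))"
proof -
  interpret graph G by fact
  let ?E = "ball_exterior G root r"
  interpret E: wf_digraph ?E unfolding ball_exterior_def by auto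
  have sub: "subgraph ?E G"
    unfolding ball_exterior_def by (rule subgraph_induce_subgraphI) auto
  have "\<exists>p. apath b1 p b2 \<and> set (awalk_verts b1 p) - {b1, b2} \<subseteq> verts G - graph_ball G root r"
    if "b1 \<in> verts G - graph_ball G root (2 * r)" "b2 \<in> verts G - graph_ball G root (2 * r)"
    for b1 b2
  proof -
    have "b1 \<rightarrow>\<^sup>*\<^bsub>?E\<^esub> b2"
      using ball_exterior_connects_far_vertices assms(2-4) that by blast
    then obtain p where p: "E.apath b1 p b2" by (auto simp: E.reachable_apath)
    have "set (awalk_verts b1 p) = set (E.awalk_verts b1 p)"
      by (simp add: ball_exterior_def awalk_verts_induce)
    also have "\<dots> \<subseteq> verts G - graph_ball G root r"
      using E.awalkI_apath[OF p] unfolding E.awalk_conv by simp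
    finally show ?thesis
      by (intro exI[of _ p] conjI subgraph_apath_imp_apath[OF p sub] subset_trans[OF Diff_subset])
  qed
  then show ?thesis unfolding disconnects_def by blast
qed

end
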